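(* Let $R'$ and $R''$ be $\mathcal{R}$-cross-sections of the semigroup $\mathcal{IS}_m\wr_p\mathcal{IS}_n$, and let $\varphi\colon R'\to R''$ be a semigroup isomorphism. Then there exists an element $\Theta=(\vartheta,\theta)\in \mathcal{S}_m\wr\mathcal{S}_n$ such that for every $(f,a)\in R'$ $$\varphi\big((f,a)\big)=\Theta^{-1}(f,a)\,\Theta .$$ In other words, if $(f,a)\in R'$ and $(g,b)=\varphi\big((f,a)\big)$, then $\operatorname{dom}(b)=\theta(\operatorname{dom}(a))$ and for every $x\in\operatorname{dom}(a)$ $$x a\theta = x\theta b,\qquad g\big(\theta(x)\big)=\vartheta^{-1}(x)\,f(x)\,\vartheta(xa).$$
   Context: $m,n$ are positive integers and $\mathcal{N}_n=\{1,\dots,n\}$. $\mathcal{IS}_n$ is the finite inverse symmetric semigroup: the set of all partial bijections of $\mathcal{N}_n$ (injective maps from a subset of $\mathcal{N}_n$ to $\mathcal{N}_n$, including the empty map), with maps written on the right and composed from left to right: $x(ab)=(xa)b$, $\operatorname{dom}(ab)=\{x\in\operatorname{dom}(a): xa\in\operatorname{dom}(b)\}$. $\mathcal{S}_n$ is the symmetric group on $\mathcal{N}_n$. The partial wreath product $\mathcal{IS}_m\wr_p\mathcal{IS}_n$ is the set of pairs $(f,a)$ with $a\in\mathcal{IS}_n$ and $f\colon\operatorname{dom}(a)\to\mathcal{IS}_m$ a function, with product $(f,a)(g,b)=(fg^a,ab)$, where $g^a(x)=g(xa)$ for $x\in\operatorname{dom}(a)$ with $xa\in\operatorname{dom}(g)$,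 and $(fg^a)(x)=f(x)g(xa)$ for $x\in\operatorname{dom}(f)\cap\operatorname{dom}(g^a)=\operatorname{dom}(ab)$. It is an inverse semigroup. The group $\mathcal{S}_m\wr\mathcal{S}_n$ consists of the pairs $(\vartheta,\theta)$ with $\theta\in\mathcal{S}_n$ and $\vartheta\colon\mathcal{N}_n\to\mathcal{S}_m$, regarded as elements of $\mathcal{IS}_m\wr_p\mathcal{IS}_n$ with the same product. Here $\theta(x)$ and $x\theta$ both denote the image of $x$ under $\theta$, and $\vartheta^{-1}(x)$ denotes the inverse $(\vartheta(x))^{-1}$ in $\mathcal{S}_m$. Green's relation $\mathcal{R}$ on an inverse semigroup $S$ with identity is $a\,\mathcal{R}\,b\Leftrightarrow aS=bS$. An $\mathcal{R}$-cross-section of $S$ is a subsemigroup of $S$ containing exactly one element from each $\mathcal{R}$-class. *)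

theory Defs
  imports "HOL-Algebra.Sym_Groups"
begin

(* Partial maps are of type nat => nat option.  Maps act on the right, so the product a b
   is "first a, then b", i.e. b \<circ>\<^sub>m a in terms of the library composition of maps. *)

definition inv_symm_sgp :: "nat \<Rightarrow> (nat \<rightharpoonup> nat) monoid" where
  "inv_symm_sgp n =
     \<lparr> carrier = {a. dom a \<subseteq> {1..n} \<and> ran a \<subseteq> {1..n} \<and> inj_on a (dom a)},
       mult = (\<lambda>a b. b \<circ>\<^sub>m a),
       one = Some |` {1..n} \<rparr>"

type_synonym pwreath_elt = "(nat \<rightharpoonup> (nat \<rightharpoonup> nat)) \<times> (nat \<rightharpoonup> nat)"

(* g \<circ>\<^sub>m a is the map g^a, and pointwise_mult m f (g \<circ>\<^sub>m a) is f g^a, which is defined on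
   dom f \<inter> dom (g^a). *)

definition pointwise_mult ::
    "nat \<Rightarrow> (nat \<rightharpoonup> (nat \<rightharpoonup> nat)) \<Rightarrow> (nat \<rightharpoonup> (nat \<rightharpoonup> nat)) \<Rightarrow> (nat \<rightharpoonup> (nat \<rightharpoonup> nat))" where
  "pointwise_mult m f h =
     (\<lambda>x. if x \<in> dom f \<inter> dom h
          then Some (the (f x) \<otimes>\<^bsub>inv_symm_sgp m\<^esub> the (h x)) else None)"

definition pwreath :: "nat \<Rightarrow> nat \<Rightarrow> pwreath_elt monoid" where
  "pwreath m n =
     \<lparr> carrier = {(f, a). a \<in> carrier (inv_symm_sgp n) \<and> dom f = dom a \<and>
                          ran f \<subseteq> carrier (inv_symm_sgp m)},
       mult = (\<lambda>(f, a) (g, b). (pointwise_mult m f (g \<circ>\<^sub>m a), a \<otimes>\<^bsub>inv_symm_sgp n\<^esub> b)),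
       one = ((\<lambda>_. Some \<one>\<^bsub>inv_symm_sgp m\<^esub>) |` {1..n}, \<one>\<^bsub>inv_symm_sgp n\<^esub>) \<rparr>"

definition green_R :: "('a, 'b) monoid_scheme \<Rightarrow> 'a rel" where
  "green_R S = {(a, b). a \<in> carrier S \<and> b \<in> carrier S \<and>
                        a <#\<^bsub>S\<^esub> carrier S = b <#\<^bsub>S\<^esub> carrier S}"

definition R_cross_section :: "('a, 'b) monoid_scheme \<Rightarrow> 'a set \<Rightarrow> bool" where
  "R_cross_section S T \<longleftrightarrow>
     T \<subseteq> carrier S \<and>
     (\<forall>x\<in>T. \<forall>y\<in>T. x \<otimes>\<^bsub>S\<^esub> y \<in> T) \<and>
     (\<forall>C \<in> carrier S // green_R S. \<exists>!t. t \<in> T \<inter> C)"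

(* perm_pmap and perm_pwreath regard permutations of {1..n} as elements of inv_symm_sgp n, and
   elements of the wreath product of symmetric groups as elements of pwreath m n.  The library
   group sym_group multiplies by ordinary composition (right to left); products are therefore
   always taken after embedding, while inverses do not depend on the convention. *)

definition perm_pmap :: "nat \<Rightarrow> (nat \<Rightarrow> nat) \<Rightarrow> (nat \<rightharpoonup> nat)" where
  "perm_pmap n p = (\<lambda>x. Some (p x)) |` {1..n}"

definition perm_pwreath ::
    "nat \<Rightarrow> nat \<Rightarrow> (nat \<Rightarrow> nat \<Rightarrow> nat) \<times> (nat \<Rightarrow> nat) \<Rightarrow> pwreath_elt" where
  "perm_pwreath m n = (\<lambda>(v, t). ((\<lambda>x. Some (perm_pmap m (v x))) |` {1..n}, perm_pmap n t))"

lemma carrier_inv_symm_sgp: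
  "a \<in> carrier (inv_symm_sgp n) \<longleftrightarrow> dom a \<subseteq> {1..n} \<and> ran a \<subseteq> {1..n} \<and> inj_on a (dom a)"
  by (simp add: inv_symm_sgp_def)

lemma mult_inv_symm_sgp: "a \<otimes>\<^bsub>inv_symm_sgp n\<^esub> b = b \<circ>\<^sub>m a"
  by (simp add: inv_symm_sgp_def)

lemma one_inv_symm_sgp: "\<one>\<^bsub>inv_symm_sgp n\<^esub> = Some |` {1..n}"
  by (simp add: inv_symm_sgp_def)

lemma carrier_inv_symm_sgp':
  "a \<in> carrier (inv_symm_sgp n) \<longleftrightarrow>
     (\<forall>x y. a x = Some y \<longrightarrow> x \<in> {1..n} \<and> y \<in> {1..n}) \<and>
     (\<forall>x x' y. a x = Some y \<longrightarrow> a x' = Some y \<longrightarrow> x = x')"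
proof
  assume "a \<in> carrier (inv_symm_sgp n)"
  then have d: "dom a \<subseteq> {1..n}" and r: "ran a \<subseteq> {1..n}" and i: "inj_on a (dom a)"
    by (auto simp: carrier_inv_symm_sgp)
  show "(\<forall>x y. a x = Some y \<longrightarrow> x \<in> {1..n} \<and> y \<in> {1..n}) \<and>
        (\<forall>x x' y. a x = Some y \<longrightarrow> a x' = Some y \<longrightarrow> x = x')"
    using d r i by (metis domI inj_onD ranI subsetD)
next
  assume *: "(\<forall>x y. a x = Some y \<longrightarrow> x \<in> {1..n} \<and> y \<in> {1..n}) \<and>
             (\<forall>x x' y. a x = Some y \<longrightarrow> a x' = Some y \<longrightarrow> x = x')"
  then have "dom a \<subseteq> {1..n}" "ran a \<subseteq> {1..n}" unfolding dom_def ran_def by blast+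
  moreover have "inj_on a (dom a)" using * by (metis domD inj_onI)
  ultimately show "a \<in> carrier (inv_symm_sgp n)" by (simp add: carrier_inv_symm_sgp)
qed

lemma map_comp_assoc: "(c \<circ>\<^sub>m b) \<circ>\<^sub>m a = c \<circ>\<^sub>m (b \<circ>\<^sub>m a)"
  by (rule ext) (auto simp: map_comp_def split: option.splits)

lemma monoid_inv_symm_sgp: "monoid (inv_symm_sgp n)"
proof (rule monoidI)
  fix a b assume a: "a \<in> carrier (inv_symm_sgp n)" and b: "b \<in> carrier (inv_symm_sgp n)"
  show "a \<otimes>\<^bsub>inv_symm_sgp n\<^esub> b \<in> carrier (inv_symm_sgp n)"
    using a b unfolding carrier_inv_symm_sgp' mult_inv_symm_sgp map_comp_Some_iff by metis
next
  show "\<one>\<^bsub>inv_symm_sgp n\<^esub> \<in> carrier (inv_symm_sgp n)"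
    unfolding carrier_inv_symm_sgp' one_inv_symm_sgp by (auto simp: restrict_map_def split: if_splits)
next
  fix a b c
  show "a \<otimes>\<^bsub>inv_symm_sgp n\<^esub> b \<otimes>\<^bsub>inv_symm_sgp n\<^esub> c = a \<otimes>\<^bsub>inv_symm_sgp n\<^esub> (b \<otimes>\<^bsub>inv_symm_sgp n\<^esub> c)"
    by (simp add: mult_inv_symm_sgp map_comp_assoc)
next
  fix a assume "a \<in> carrier (inv_symm_sgp n)"
  then have a: "\<And>x y. a x = Some y \<Longrightarrow> x \<in> {1..n} \<and> y \<in> {1..n}"
    unfolding carrier_inv_symm_sgp' by blast
  show "\<one>\<^bsub>inv_symm_sgp n\<^esub> \<otimes>\<^bsub>inv_symm_sgp n\<^esub> a = a"
    unfolding mult_inv_symm_sgp one_inv_symm_sgp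
  proof
    fix x show "(a \<circ>\<^sub>m Some |` {1..n}) x = a x"
      using a[of x] by (cases "a x") (auto simp: map_comp_def restrict_map_def)
  qed
  show "a \<otimes>\<^bsub>inv_symm_sgp n\<^esub> \<one>\<^bsub>inv_symm_sgp n\<^esub> = a"
    unfolding mult_inv_symm_sgp one_inv_symm_sgp
  proof
    fix x show "(Some |` {1..n} \<circ>\<^sub>m a) x = a x"
      using a[of x] by (cases "a x") (auto simp: map_comp_def restrict_map_def)
  qed
qed

lemma carrier_pwreath:
  "(f, a) \<in> carrier (pwreath m n) \<longleftrightarrow>
     a \<in> carrier (inv_symm_sgp n) \<and> dom f = dom a \<and> ran f \<subseteq> carrier (inv_symm_sgp m)"
  by (simp add: pwreath_def)

lemma mult_pwreath:
  "(f, a) \<otimes>\<^bsub>pwreath m n\<^esub> (g, b) = (pointwise_mult m f (g \<circ>\<^sub>m a), a \<otimes>\<^bsub>inv_symm_sgp n\<^esub> b)"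
  by (simp add: pwreath_def)

lemma one_pwreath:
  "\<one>\<^bsub>pwreath m n\<^esub> = ((\<lambda>_. Some \<one>\<^bsub>inv_symm_sgp m\<^esub>) |` {1..n}, \<one>\<^bsub>inv_symm_sgp n\<^esub>)"
  by (simp add: pwreath_def)

lemma carrier_pwreath':
  "(f, a) \<in> carrier (pwreath m n) \<longleftrightarrow>
     a \<in> carrier (inv_symm_sgp n) \<and> (\<forall>x. f x = None \<longleftrightarrow> a x = None) \<and>
     (\<forall>x u. f x = Some u \<longrightarrow> u \<in> carrier (inv_symm_sgp m))"
proof -
  have "dom f = dom a \<longleftrightarrow> (\<forall>x. f x = None \<longleftrightarrow> a x = None)"
    unfolding dom_def set_eq_iff mem_Collect_eq by metis
  moreover have "ran f \<subseteq> carrier (inv_symm_sgp m) \<longleftrightarrow>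
                 (\<forall>x u. f x = Some u \<longrightarrow> u \<in> carrier (inv_symm_sgp m))"
    unfolding ran_def by blast
  ultimately show ?thesis by (simp add: carrier_pwreath)
qed

lemma pointwise_mult_app:
  "pointwise_mult m f h x = (case f x of None \<Rightarrow> None
     | Some u \<Rightarrow> (case h x of None \<Rightarrow> None | Some v \<Rightarrow> Some (u \<otimes>\<^bsub>inv_symm_sgp m\<^esub> v)))"
  by (auto simp: pointwise_mult_def split: option.splits)

lemma monoid_pwreath: "monoid (pwreath m n)"
proof -
  interpret M: monoid "inv_symm_sgp m" by (rule monoid_inv_symm_sgp)
  interpret N: monoid "inv_symm_sgp n" by (rule monoid_inv_symm_sgp)
  show ?thesis
  proof (rule monoidI)
    fix p q assume pq: "p \<in> carrier (pwreath m n)" "q \<in> carrier (pwreath m n)"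
    obtain f a g b where e: "p = (f, a)" "q = (g, b)" by fastforce
    have "a \<otimes>\<^bsub>inv_symm_sgp n\<^esub> b \<in> carrier (inv_symm_sgp n)"
      using pq by (auto simp: e carrier_pwreath')
    moreover have "pointwise_mult m f (g \<circ>\<^sub>m a) x = None \<longleftrightarrow> (a \<otimes>\<^bsub>inv_symm_sgp n\<^esub> b) x = None" for x
    proof -
      have "f x = None \<longleftrightarrow> a x = None" "\<And>y. g y = None \<longleftrightarrow> b y = None"
        using pq by (auto simp: e carrier_pwreath')
      then show ?thesis
        by (simp add: pointwise_mult_app mult_inv_symm_sgp map_comp_def del: not_None_eq
            split: option.split) (metis option.distinct(1))
    qed
    moreover have "u \<in> carrier (inv_symm_sgp m)" if "pointwise_mult m f (g \<circ>\<^sub>m a) x = Some u" for x u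
      using pq that by (auto simp: e carrier_pwreath' pointwise_mult_app
          map_comp_def split: option.splits)
    ultimately show "p \<otimes>\<^bsub>pwreath m n\<^esub> q \<in> carrier (pwreath m n)"
      unfolding e mult_pwreath carrier_pwreath' by blast
  next
    show "\<one>\<^bsub>pwreath m n\<^esub> \<in> carrier (pwreath m n)"
      using M.one_closed N.one_closed unfolding carrier_pwreath' one_pwreath
      by (auto simp: restrict_map_def one_inv_symm_sgp[of n] split: if_splits)
  next
    fix p q r
    assume pqr: "p \<in> carrier (pwreath m n)" "q \<in> carrier (pwreath m n)" "r \<in> carrier (pwreath m n)"
    obtain f a g b h c where e: "p = (f, a)" "q = (g, b)" "r = (h, c)" by (metis surj_pair)
    have f: "\<And>x u. f x = Some u \<Longrightarrow> u \<in> carrier (inv_symm_sgp m)"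
      and g: "\<And>x u. g x = Some u \<Longrightarrow> u \<in> carrier (inv_symm_sgp m)"
      and h: "\<And>x u. h x = Some u \<Longrightarrow> u \<in> carrier (inv_symm_sgp m)"
      and gb: "\<And>x. g x = None \<longleftrightarrow> b x = None"
      using pqr by (auto simp: e carrier_pwreath')
    have "pointwise_mult m (pointwise_mult m f (g \<circ>\<^sub>m a)) (h \<circ>\<^sub>m (b \<circ>\<^sub>m a)) x =
          pointwise_mult m f (pointwise_mult m g (h \<circ>\<^sub>m b) \<circ>\<^sub>m a) x" for x
      using f[of x] g h gb
      by (simp add: pointwise_mult_app map_comp_def M.m_assoc split: option.split)
    then show "p \<otimes>\<^bsub>pwreath m n\<^esub> q \<otimes>\<^bsub>pwreath m n\<^esub> r = p \<otimes>\<^bsub>pwreath m n\<^esub> (q \<otimes>\<^bsub>pwreath m n\<^esub> r)"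
      by (simp add: e mult_pwreath mult_inv_symm_sgp[where n = n] map_comp_assoc fun_eq_iff)
  next
    fix p assume "p \<in> carrier (pwreath m n)"
    moreover obtain f a where p: "p = (f, a)" by fastforce
    ultimately have P: "a \<in> carrier (inv_symm_sgp n)" "\<And>x. f x = None \<longleftrightarrow> a x = None"
      "\<And>x u. f x = Some u \<Longrightarrow> u \<in> carrier (inv_symm_sgp m)"
      by (auto simp: carrier_pwreath')
    have D: "\<And>x y. a x = Some y \<Longrightarrow> x \<in> {1..n} \<and> y \<in> {1..n}"
      using P(1) unfolding carrier_inv_symm_sgp' by blast
    have "pointwise_mult m ((\<lambda>_. Some \<one>\<^bsub>inv_symm_sgp m\<^esub>) |` {1..n}) (f \<circ>\<^sub>m (Some |` {1..n})) x = f x" for x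
    proof (cases "f x")
      case (Some u)
      then obtain y where "a x = Some y" using P(2)[of x] by auto
      with D[of x y] Some P(3)[OF Some] show ?thesis
        by (auto simp: pointwise_mult_app map_comp_def restrict_map_def)
    qed (auto simp: pointwise_mult_app map_comp_def restrict_map_def)
    then show "\<one>\<^bsub>pwreath m n\<^esub> \<otimes>\<^bsub>pwreath m n\<^esub> p = p"
      using N.l_one[OF P(1)] by (auto simp: p one_pwreath mult_pwreath one_inv_symm_sgp[of n])
    have "pointwise_mult m f (((\<lambda>_. Some \<one>\<^bsub>inv_symm_sgp m\<^esub>) |` {1..n}) \<circ>\<^sub>m a) x = f x" for x
    proof (cases "f x")
      case (Some u)
      then obtain y where "a x = Some y" using P(2)[of x] by auto
      with D[of x y] Some P(3)[OF Some] show ?thesis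
        by (auto simp: pointwise_mult_app map_comp_def restrict_map_def)
    qed (auto simp: pointwise_mult_app map_comp_def restrict_map_def)
    then show "p \<otimes>\<^bsub>pwreath m n\<^esub> \<one>\<^bsub>pwreath m n\<^esub> = p"
      using N.r_one[OF P(1)] by (auto simp: p one_pwreath mult_pwreath)
  qed
qed

lemma perm_pmap_carrier:
  assumes "p permutes {1..n}" shows "perm_pmap n p \<in> carrier (inv_symm_sgp n)"
  using permutes_in_image[OF assms] inj_onD[OF permutes_inj[OF assms]]
  by (auto simp: carrier_inv_symm_sgp' perm_pmap_def restrict_map_def split: if_splits)

lemma perm_pmap_mult:
  assumes "p permutes {1..n}"
  shows "perm_pmap n p \<otimes>\<^bsub>inv_symm_sgp n\<^esub> perm_pmap n q = perm_pmap n (q \<circ> p)"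
  using permutes_in_image[OF assms]
  by (auto simp: mult_inv_symm_sgp perm_pmap_def restrict_map_def map_comp_def fun_eq_iff)

lemma perm_pmap_id: "perm_pmap n id = \<one>\<^bsub>inv_symm_sgp n\<^esub>"
  by (auto simp: one_inv_symm_sgp perm_pmap_def restrict_map_def)

lemma perm_pwreath_carrier:
  assumes "v \<in> {1..n} \<rightarrow> carrier (sym_group m)" and "t \<in> carrier (sym_group n)"
  shows "perm_pwreath m n (v, t) \<in> carrier (pwreath m n)"
proof -
  have "perm_pmap n t \<in> carrier (inv_symm_sgp n)"
    using assms(2) by (simp add: sym_group_carrier perm_pmap_carrier)
  moreover have "perm_pmap m (v x) \<in> carrier (inv_symm_sgp m)" if "x \<in> {1..n}" for x
    using assms(1) that by (intro perm_pmap_carrier) (auto simp: sym_group_carrier)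
  moreover have "((\<lambda>x. Some (perm_pmap m (v x))) |` {1..n}) x = None \<longleftrightarrow> perm_pmap n t x = None" for x
    by (simp add: perm_pmap_def restrict_map_def)
  ultimately show ?thesis
    by (simp add: perm_pwreath_def carrier_pwreath' restrict_map_def)
qed

lemma perm_pwreath_mult:
  assumes "v \<in> {1..n} \<rightarrow> carrier (sym_group m)" and "t \<in> carrier (sym_group n)"
  shows "perm_pwreath m n (v, t) \<otimes>\<^bsub>pwreath m n\<^esub> perm_pwreath m n (w, s) =
         perm_pwreath m n (\<lambda>x. w (t x) \<circ> v x, s \<circ> t)"
proof -
  have t: "t permutes {1..n}" using assms(2) by (simp add: sym_group_carrier)
  have v: "v x permutes {1..m}" if "x \<in> {1..n}" for x
    using assms(1) that by (auto simp: sym_group_carrier)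
  have "pointwise_mult m ((\<lambda>x. Some (perm_pmap m (v x))) |` {1..n})
          (((\<lambda>x. Some (perm_pmap m (w x))) |` {1..n}) \<circ>\<^sub>m perm_pmap n t) x =
        ((\<lambda>x. Some (perm_pmap m (w (t x) \<circ> v x))) |` {1..n}) x" for x
  proof (cases "x \<in> {1..n}")
    case True
    then have "t x \<in> {1..n}" using permutes_in_image[OF t] by blast
    with True perm_pmap_mult[OF v[OF True]] show ?thesis
      by (simp add: pointwise_mult_app map_comp_def perm_pmap_def[of n])
  qed (simp add: pointwise_mult_app)
  then show ?thesis
    by (simp add: perm_pwreath_def mult_pwreath perm_pmap_mult[OF t] fun_eq_iff)
qed

lemma perm_pwreath_Units:
  assumes "v \<in> {1..n} \<rightarrow> carrier (sym_group m)" and "t \<in> carrier (sym_group n)"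
  shows "perm_pwreath m n (v, t) \<in> Units (pwreath m n)"
proof -
  let ?s = "inv' t" and ?w = "\<lambda>x. inv' (v (inv' t x))"
  have t: "t permutes {1..n}" using assms(2) by (simp add: sym_group_carrier)
  have v: "v x permutes {1..m}" if "x \<in> {1..n}" for x
    using assms(1) that by (auto simp: sym_group_carrier)
  have s: "?s permutes {1..n}" by (rule permutes_inv[OF t])
  have si: "?s x \<in> {1..n}" if "x \<in> {1..n}" for x using permutes_in_image[OF s] that by blast
  have wc: "?w \<in> {1..n} \<rightarrow> carrier (sym_group m)"
    using permutes_inv[OF v[OF si]] by (auto simp: sym_group_carrier)
  have sc: "?s \<in> carrier (sym_group n)" using s by (simp add: sym_group_carrier)
  have one: "perm_pwreath m n (u, id) = \<one>\<^bsub>pwreath m n\<^esub>" if "\<And>x. x \<in> {1..n} \<Longrightarrow> u x = id" for u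
    using that by (auto simp: perm_pwreath_def one_pwreath perm_pmap_id restrict_map_def)
  have "perm_pwreath m n (v, t) \<otimes>\<^bsub>pwreath m n\<^esub> perm_pwreath m n (?w, ?s) = \<one>\<^bsub>pwreath m n\<^esub>"
    unfolding perm_pwreath_mult[OF assms] permutes_inv_o(2)[OF t]
    using permutes_inv_o(2)[OF v] by (intro one) (simp add: permutes_inverses[OF t])
  moreover have "perm_pwreath m n (?w, ?s) \<otimes>\<^bsub>pwreath m n\<^esub> perm_pwreath m n (v, t) = \<one>\<^bsub>pwreath m n\<^esub>"
    unfolding perm_pwreath_mult[OF wc sc] permutes_inv_o(1)[OF t]
    using permutes_inv_o(1)[OF v[OF si]] by (intro one) simp
  ultimately show ?thesis
    using perm_pwreath_carrier[OF assms] perm_pwreath_carrier[OF wc sc]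
    unfolding Units_def by blast
qed

end

theory Submission
  imports Defs
begin

text \<open>The idea is that an R-cross-section remembers the forest on which the semigroup acts.

  Let the pair (f, a) act on the forest with roots 1, ..., n and m leaves at each root: a moves the
  roots, and f x moves the leaves at the root x to the leaves at the image of x. Ordered with the
  roots at the bottom, the forest is a poset, and the partial wreath product is exactly the
  semigroup of its isomorphisms between downsets (\<open>act_mult\<close>, \<open>act_inj\<close>, \<open>act_partial_auto\<close>,
  \<open>act_surj\<close>). Two elements are R-related if and only if they have the same domain
  (\<open>green_R_iff_same_dom\<close>), so a cross-section contains exactly one element \<open>r\<^sub>D\<close> for each downset D.

  In such a semigroup E is contained in D if and only if \<open>r\<^sub>E\<close> is a right multiple of \<open>r\<^sub>D\<close>
  by an element of the cross-section (\<open>domain_transversal_dom_subset_iff\<close>). Hence an isomorphism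
  of cross-sections induces an automorphism of the lattice of downsets. As the principal downsets
  are recognised by inclusion alone, this lattice automorphism comes from an automorphism
  \<open>\<pi>\<close> of the forest (\<open>downset_iso_induced_by_order_iso\<close>), that is, from an element of the wreath
  product of the two symmetric groups (\<open>forest_automorphism_is_perm\<close>).

  It remains to see that the isomorphism is conjugation by this element. The domain of
  \<open>r\<^sub>D\<close> followed by \<open>r\<^sub>E\<close> is the preimage of E under \<open>r\<^sub>D\<close>. So all preimages of downsets
  under \<open>r\<^sub>D\<close> are carried by \<open>\<pi>\<close> to the preimages of the corresponding downsets under the image of
  \<open>r\<^sub>D\<close>, and since downsets separate points, this determines the image of \<open>r\<^sub>D\<close> pointwise
  (\<open>domain_transversal_iso_induced_by_order_iso\<close>).\<close>

section \<open>Downsets of a poset\<close>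

definition downsets :: "'a rel \<Rightarrow> 'a set set" where
  "downsets r = {D. D \<subseteq> Field r \<and> (\<forall>q\<in>D. under r q \<subseteq> D)}"

lemma under_in_downsets:
  assumes "Partial_order r" shows "under r p \<in> downsets r"
  unfolding downsets_def under_def
  using transD[OF partial_order_onD(2)[OF assms]] by (blast intro: FieldI1)

lemma under_subset_iff:
  assumes "Partial_order r" "p \<in> Field r" "D \<in> downsets r"
  shows "under r p \<subseteq> D \<longleftrightarrow> p \<in> D"
  using assms(2,3) refl_onD[OF partial_order_onD(1)[OF assms(1)] assms(2)]
  unfolding downsets_def under_def by blast

text \<open>Since x lies in the downset generated by y exactly when x is below y, two elements lying in
  the same downsets are below each other.\<close>
lemma separated_by_downsets:
  assumes "Partial_order r" "p \<in> Field r" "q \<in> Field r"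
    and "\<And>D. D \<in> downsets r \<Longrightarrow> p \<in> D \<longleftrightarrow> q \<in> D"
  shows "p = q"
proof -
  have "p \<in> under r q" "q \<in> under r p"
    using assms(4)[OF under_in_downsets[OF assms(1)]] assms(2,3)
      refl_onD[OF partial_order_onD(1)[OF assms(1)]] unfolding under_def by blast+
  then show ?thesis
    using antisymD[OF partial_order_onD(3)[OF assms(1)]] unfolding under_def by blast
qed

text \<open>A description of the downsets with a top element that mentions only inclusion between
  downsets, and hence is preserved by every inclusion isomorphism. Removing the top element gives
  the greatest proper subdownset M; conversely any element outside M must generate the whole
  downset, because what it generates is not contained in M.\<close>
lemma principal_iff_greatest_proper:
  assumes "Partial_order r" "D \<in> downsets r"
  shows "(\<exists>p\<in>Field r. D = under r p) \<longleftrightarrow>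
         (\<exists>M\<in>downsets r. M \<subset> D \<and> (\<forall>E\<in>downsets r. E \<subset> D \<longrightarrow> E \<subseteq> M))"
proof
  assume "\<exists>p\<in>Field r. D = under r p"
  then obtain p where p: "p \<in> Field r" "D = under r p" by blast
  have pp: "p \<in> under r p"
    using refl_onD[OF partial_order_onD(1)[OF assms(1)] p(1)] by (simp add: under_def)
  have "x \<in> D - {p}" if "y \<in> D - {p}" "(x, y) \<in> r" for x y
  proof -
    have y: "(y, p) \<in> r" "y \<noteq> p" using that(1) by (auto simp: p(2) under_def)
    have "(x, p) \<in> r" by (rule transD[OF partial_order_onD(2)[OF assms(1)] that(2) y(1)])
    moreover have "x \<noteq> p"
      using antisymD[OF partial_order_onD(3)[OF assms(1)] y(1)] that(2) y(2) by blast
    ultimately show ?thesis by (simp add: p(2) under_def)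
  qed
  then have "D - {p} \<in> downsets r" using assms(2) unfolding downsets_def under_def by blast
  moreover have "D - {p} \<subset> D" using pp p(2) by auto
  moreover have "E \<subseteq> D - {p}" if "E \<in> downsets r" "E \<subset> D" for E
    using under_subset_iff[OF assms(1) p(1) that(1)] that p(2) by auto
  ultimately show "\<exists>M\<in>downsets r. M \<subset> D \<and> (\<forall>E\<in>downsets r. E \<subset> D \<longrightarrow> E \<subseteq> M)"
    by (intro bexI[of _ "D - {p}"]) simp_all
next
  assume "\<exists>M\<in>downsets r. M \<subset> D \<and> (\<forall>E\<in>downsets r. E \<subset> D \<longrightarrow> E \<subseteq> M)"
  then obtain M where M: "M \<in> downsets r" "M \<subset> D"
    "\<And>E. E \<in> downsets r \<Longrightarrow> E \<subset> D \<Longrightarrow> E \<subseteq> M" by metis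
  then obtain p where p: "p \<in> D" "p \<notin> M" by blast
  have pF: "p \<in> Field r" using p(1) assms(2) by (auto simp: downsets_def)
  have "under r p \<subseteq> D" "\<not> under r p \<subseteq> M"
    using under_subset_iff[OF assms(1) pF] p assms(2) M(1) by auto
  then have "D = under r p" using M(3)[OF under_in_downsets[OF assms(1), of p]] by auto
  with pF show "\<exists>p\<in>Field r. D = under r p" by blast
qed

lemma downset_iso_principal:
  assumes "Partial_order r" "Partial_order s"
    and \<delta>: "bij_betw \<delta> (downsets r) (downsets s)"
    and mono: "\<And>D E. D \<in> downsets r \<Longrightarrow> E \<in> downsets r \<Longrightarrow> \<delta> D \<subseteq> \<delta> E \<longleftrightarrow> D \<subseteq> E"
    and D: "D \<in> downsets r"
  shows "(\<exists>p\<in>Field r. D = under r p) \<longleftrightarrow> (\<exists>q\<in>Field s. \<delta> D = under s q)"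
proof -
  have im: "downsets s = \<delta> ` downsets r" using \<delta> by (simp add: bij_betw_def)
  have \<delta>D: "\<delta> D \<in> downsets s" using D im by blast
  have psub: "\<delta> E \<subset> \<delta> D \<longleftrightarrow> E \<subset> D" if "E \<in> downsets r" for E
    by (simp add: less_le_not_le mono[OF that D] mono[OF D that])
  have "(\<exists>q\<in>Field s. \<delta> D = under s q) \<longleftrightarrow>
      (\<exists>M\<in>downsets r. \<delta> M \<subset> \<delta> D \<and> (\<forall>E\<in>downsets r. \<delta> E \<subset> \<delta> D \<longrightarrow> \<delta> E \<subseteq> \<delta> M))"
    unfolding principal_iff_greatest_proper[OF assms(2) \<delta>D] by (simp add: im)
  also have "\<dots> \<longleftrightarrow> (\<exists>M\<in>downsets r. M \<subset> D \<and> (\<forall>E\<in>downsets r. E \<subset> D \<longrightarrow> E \<subseteq> M))"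
    by (intro bex_cong ball_cong conj_cong refl imp_cong psub mono)
  finally show ?thesis unfolding principal_iff_greatest_proper[OF assms(1) D] by (rule sym)
qed

text \<open>The point map is read off from the principal downsets, which an inclusion isomorphism preserves.
  It determines \<open>\<delta>\<close> everywhere because membership of a point in a downset is inclusion of the
  principal downset of that point.\<close>
lemma downset_iso_induced_by_order_iso:
  assumes "Partial_order r" "Partial_order s"
    and \<delta>: "bij_betw \<delta> (downsets r) (downsets s)"
    and mono: "\<And>D E. D \<in> downsets r \<Longrightarrow> E \<in> downsets r \<Longrightarrow> \<delta> D \<subseteq> \<delta> E \<longleftrightarrow> D \<subseteq> E"
  obtains \<pi> where "bij_betw \<pi> (Field r) (Field s)"
    and "\<And>p q. p \<in> Field r \<Longrightarrow> q \<in> Field r \<Longrightarrow> (\<pi> p, \<pi> q) \<in> s \<longleftrightarrow> (p, q) \<in> r"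
    and "\<And>D. D \<in> downsets r \<Longrightarrow> \<delta> D = \<pi> ` D"
proof -
  have princ: "(\<exists>p\<in>Field r. D = under r p) \<longleftrightarrow> (\<exists>q\<in>Field s. \<delta> D = under s q)"
    if "D \<in> downsets r" for D
    using assms that by (rule downset_iso_principal)
  have ur: "under r p \<in> downsets r" and us: "under s q \<in> downsets s" for p q
    by (rule under_in_downsets[OF assms(1)], rule under_in_downsets[OF assms(2)])
  have "\<forall>p\<in>Field r. \<exists>q. q \<in> Field s \<and> \<delta> (under r p) = under s q"
    using princ[OF ur] by blast
  then obtain \<pi> where \<pi>: "\<And>p. p \<in> Field r \<Longrightarrow> \<pi> p \<in> Field s"
    and under_\<pi>: "\<And>p. p \<in> Field r \<Longrightarrow> \<delta> (under r p) = under s (\<pi> p)" by metis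
  have mem: "\<pi> p \<in> \<delta> D \<longleftrightarrow> p \<in> D" if "p \<in> Field r" "D \<in> downsets r" for p D
  proof -
    have "\<delta> D \<in> downsets s" using that \<delta> by (auto simp: bij_betw_def)
    then show ?thesis
      using under_subset_iff[OF assms(2) \<pi>[OF that(1)]] under_subset_iff[OF assms(1) that]
        mono[OF ur that(2)] under_\<pi>[OF that(1)] by metis
  qed
  have le: "(\<pi> p, \<pi> q) \<in> s \<longleftrightarrow> (p, q) \<in> r" if "p \<in> Field r" "q \<in> Field r" for p q
    using mem[OF that(1) ur, of q] under_\<pi>[OF that(2)] by (simp add: under_def)
  have inj: "inj_on \<pi> (Field r)"
  proof (rule inj_onI)
    fix p q assume pq: "p \<in> Field r" "q \<in> Field r" "\<pi> p = \<pi> q"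
    show "p = q"
      by (rule separated_by_downsets[OF assms(1) pq(1,2)]) (metis mem pq)
  qed
  have surj: "q \<in> \<pi> ` Field r" if q: "q \<in> Field s" for q
  proof -
    obtain D where D: "D \<in> downsets r" "\<delta> D = under s q"
      using us[of q] \<delta> by (metis bij_betw_imp_surj_on imageE)
    then obtain p where p: "p \<in> Field r" "D = under r p" using princ[OF D(1)] q by blast
    have "under s (\<pi> p) = under s q" using D(2) under_\<pi>[OF p(1)] p(2) by simp
    then have "\<pi> p = q"
      using under_subset_iff[OF assms(2) q us] under_subset_iff[OF assms(2) \<pi>[OF p(1)] us]
        antisymD[OF partial_order_onD(3)[OF assms(2)]]
      unfolding under_def by blast
    with p show ?thesis by blast
  qed
  have bij: "bij_betw \<pi> (Field r) (Field s)" using inj surj \<pi> by (auto simp: bij_betw_def)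
  have "\<delta> D = \<pi> ` D" if D: "D \<in> downsets r" for D
  proof -
    have "\<delta> D \<in> downsets s" using D \<delta> by (auto simp: bij_betw_def)
    then have "\<delta> D \<subseteq> \<pi> ` Field r" using surj by (auto simp: downsets_def)
    moreover have "D \<subseteq> Field r" using D by (auto simp: downsets_def)
    ultimately show ?thesis using mem[OF _ D] by blast
  qed
  with bij le show ?thesis using that by blast
qed

section \<open>Partial automorphisms between downsets\<close>

text \<open>Domain and range both have to be downsets: on a poset with several levels this is what forces
  minimal elements to go to minimal elements, and it makes the set closed under inversion.\<close>
definition partial_autos :: "'a rel \<Rightarrow> ('a \<rightharpoonup> 'a) set" where
  "partial_autos r = {h. dom h \<in> downsets r \<and> ran h \<in> downsets r \<and>
     (\<forall>x x' y y'. h x = Some y \<longrightarrow> h x' = Some y' \<longrightarrow> ((x, x') \<in> r \<longleftrightarrow> (y, y') \<in> r))}"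

lemma partial_autos_iff:
  "h \<in> partial_autos r \<longleftrightarrow>
     (\<forall>x y. h x = Some y \<longrightarrow> x \<in> Field r \<and> y \<in> Field r) \<and>
     (\<forall>x x' y y'. h x = Some y \<longrightarrow> h x' = Some y' \<longrightarrow> ((x, x') \<in> r \<longleftrightarrow> (y, y') \<in> r)) \<and>
     (\<forall>x' y' x. h x' = Some y' \<longrightarrow> (x, x') \<in> r \<longrightarrow> (\<exists>y. h x = Some y)) \<and>
     (\<forall>x' y' y. h x' = Some y' \<longrightarrow> (y, y') \<in> r \<longrightarrow> (\<exists>x. h x = Some y))"
proof -
  have "dom h \<in> downsets r \<longleftrightarrow> (\<forall>x y. h x = Some y \<longrightarrow> x \<in> Field r) \<and>
     (\<forall>x' y' x. h x' = Some y' \<longrightarrow> (x, x') \<in> r \<longrightarrow> (\<exists>y. h x = Some y))"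
    unfolding downsets_def under_def dom_def by blast
  moreover have "ran h \<in> downsets r \<longleftrightarrow> (\<forall>x y. h x = Some y \<longrightarrow> y \<in> Field r) \<and>
     (\<forall>x' y' y. h x' = Some y' \<longrightarrow> (y, y') \<in> r \<longrightarrow> (\<exists>x. h x = Some y))"
    unfolding downsets_def under_def ran_def by blast
  ultimately show ?thesis unfolding partial_autos_def by blast
qed

lemma partial_autosD:
  assumes "h \<in> partial_autos r"
  shows "h x = Some y \<Longrightarrow> x \<in> Field r" "h x = Some y \<Longrightarrow> y \<in> Field r"
    and "h x = Some y \<Longrightarrow> h x' = Some y' \<Longrightarrow> (x, x') \<in> r \<longleftrightarrow> (y, y') \<in> r"
    and "h x' = Some y' \<Longrightarrow> (x, x') \<in> r \<Longrightarrow> \<exists>y. h x = Some y"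
    and "h x' = Some y' \<Longrightarrow> (y, y') \<in> r \<Longrightarrow> \<exists>x. h x = Some y"
  using assms unfolding partial_autos_iff by blast+

lemma partial_auto_inj:
  assumes "Partial_order r" "h \<in> partial_autos r" "h x = Some y" "h x' = Some y"
  shows "x = x'"
proof -
  have "(y, y) \<in> r"
    using assms(2,3) refl_onD[OF partial_order_onD(1)[OF assms(1)]]
    unfolding partial_autos_iff by blast
  then have "(x, x') \<in> r" "(x', x) \<in> r" using assms(2-4) unfolding partial_autos_iff by blast+
  then show ?thesis by (rule antisymD[OF partial_order_onD(3)[OF assms(1)]])
qed

text \<open>The semigroup of partial automorphisms is inverse; this is what turns inclusion of domains
  into divisibility.\<close>
lemma partial_auto_converse:
  assumes "Partial_order r" "h \<in> partial_autos r"
  obtains k where "k \<in> partial_autos r" "\<And>x y. k y = Some x \<longleftrightarrow> h x = Some y"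
proof -
  define k where "k y = (if y \<in> ran h then Some (SOME x. h x = Some y) else None)" for y
  have k: "k y = Some x \<longleftrightarrow> h x = Some y" for x y
  proof
    assume "k y = Some x"
    then show "h x = Some y" by (auto simp: k_def ran_def split: if_splits intro: someI)
  next
    assume x: "h x = Some y"
    then have "(SOME x. h x = Some y) = x"
      using partial_auto_inj[OF assms] by blast
    then show "k y = Some x" using ranI[of h, OF x] by (simp add: k_def)
  qed
  moreover have "k \<in> partial_autos r"
    using assms(2) unfolding partial_autos_iff k by blast
  ultimately show ?thesis using that by blast
qed

lemma partial_auto_restrict_id:
  assumes "D \<in> downsets r" shows "Some |` D \<in> partial_autos r"
  using assms by (auto simp: partial_autos_iff restrict_map_def downsets_def under_def)

lemma dom_map_comp: "dom (t \<circ>\<^sub>m s) = {x. \<exists>y\<in>dom t. s x = Some y}"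
  by (auto simp: dom_def map_comp_def split: option.splits)

lemma partial_auto_image_downset:
  assumes h: "h \<in> partial_autos r" and E: "E \<in> downsets r"
  shows "{y. \<exists>x\<in>E. h x = Some y} \<in> downsets r"
proof -
  have "\<exists>x\<in>E. h x = Some y" if x': "x' \<in> E" "h x' = Some y'" and le: "(y, y') \<in> r" for x' y y'
  proof -
    obtain x where x: "h x = Some y" using partial_autosD(5)[OF h x'(2) le] by blast
    then have "(x, x') \<in> r" using partial_autosD(3)[OF h x x'(2)] le by blast
    then show ?thesis using x E x'(1) unfolding downsets_def under_def by blast
  qed
  then show ?thesis using partial_autosD(2)[OF h] unfolding downsets_def under_def by blast
qed

section \<open>Semigroups with one partial automorphism per domain\<close>

text \<open>The counterpart for partial automorphisms of a cross-section for Green's relation R, whose classes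
  consist of the elements with a common domain.\<close>
definition domain_transversal :: "'a rel \<Rightarrow> ('a \<rightharpoonup> 'a) set \<Rightarrow> bool" where
  "domain_transversal r T \<longleftrightarrow> T \<subseteq> partial_autos r \<and> bij_betw dom T (downsets r) \<and>
     (\<forall>s\<in>T. \<forall>t\<in>T. t \<circ>\<^sub>m s \<in> T)"

text \<open>Inclusion of domains is visible in the multiplication of the transversal alone. If the domain
  of s is contained in that of t, let u be the element whose domain is the image of the former
  under t: then u after t has the same domain as s, so it is s. The witness u lies in the
  transversal itself, so an isomorphism of transversals transports it.\<close>
lemma domain_transversal_dom_subset_iff:
  assumes "Partial_order r" "domain_transversal r T" "s \<in> T" "t \<in> T"
  shows "dom s \<subseteq> dom t \<longleftrightarrow> (\<exists>u\<in>T. s = u \<circ>\<^sub>m t)"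
proof
  assume sub: "dom s \<subseteq> dom t"
  have s: "dom s \<in> downsets r" and t: "t \<in> partial_autos r"
    using assms unfolding domain_transversal_def bij_betw_def by blast+
  have "{y. \<exists>x\<in>dom s. t x = Some y} \<in> dom ` T"
    using partial_auto_image_downset[OF t s] assms(2)
    unfolding domain_transversal_def bij_betw_def by simp
  then obtain u where u: "u \<in> T" "dom u = {y. \<exists>x\<in>dom s. t x = Some y}" by fastforce
  have "x \<in> dom (u \<circ>\<^sub>m t) \<longleftrightarrow> x \<in> dom s" for x
  proof
    assume "x \<in> dom (u \<circ>\<^sub>m t)"
    then obtain x' y where "x' \<in> dom s" "t x = Some y" "t x' = Some y"
      by (auto simp: dom_map_comp u(2))
    then show "x \<in> dom s" using partial_auto_inj[OF assms(1) t] by metis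
  next
    assume "x \<in> dom s"
    moreover from this obtain y where "t x = Some y" using sub by blast
    ultimately show "x \<in> dom (u \<circ>\<^sub>m t)" by (auto simp: dom_map_comp u(2))
  qed
  then have "dom (u \<circ>\<^sub>m t) = dom s" by blast
  moreover have "u \<circ>\<^sub>m t \<in> T" "inj_on dom T"
    using assms u unfolding domain_transversal_def bij_betw_def by blast+
  ultimately have "s = u \<circ>\<^sub>m t" using assms(3) by (auto dest: inj_onD)
  with u(1) show "\<exists>u\<in>T. s = u \<circ>\<^sub>m t" by blast
next
  assume "\<exists>u\<in>T. s = u \<circ>\<^sub>m t"
  then show "dom s \<subseteq> dom t" unfolding dom_map_comp by (auto simp: map_comp_def split: option.splits)
qed

text \<open>By the previous lemma an isomorphism of transversals induces an isomorphism of downset lattices,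
  hence an order isomorphism \<open>\<pi>\<close> of the posets that describes what happens to domains. The values
  are then determined by the domains of products: p lies in the domain of t after s if and only if
  s p lies in the domain of t, and this domain can be any downset, so it pins down s p.\<close>
theorem domain_transversal_iso_induced_by_order_iso:
  assumes r: "Partial_order r" and r': "Partial_order r'"
    and T: "domain_transversal r T" and T': "domain_transversal r' T'"
    and \<psi>: "bij_betw \<psi> T T'"
    and hom: "\<And>s t. s \<in> T \<Longrightarrow> t \<in> T \<Longrightarrow> \<psi> (t \<circ>\<^sub>m s) = \<psi> t \<circ>\<^sub>m \<psi> s"
  obtains \<pi> where "bij_betw \<pi> (Field r) (Field r')"
    and "\<And>p q. p \<in> Field r \<Longrightarrow> q \<in> Field r \<Longrightarrow> (\<pi> p, \<pi> q) \<in> r' \<longleftrightarrow> (p, q) \<in> r"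
    and "\<And>s p. s \<in> T \<Longrightarrow> p \<in> Field r \<Longrightarrow> \<psi> s (\<pi> p) = map_option \<pi> (s p)"
proof -
  have dT: "bij_betw dom T (downsets r)" and dT': "bij_betw dom T' (downsets r')"
    and cl: "\<And>s t. s \<in> T \<Longrightarrow> t \<in> T \<Longrightarrow> t \<circ>\<^sub>m s \<in> T"
    using T T' unfolding domain_transversal_def by blast+
  have \<psi>T: "\<psi> s \<in> T'" if "s \<in> T" for s using \<psi> that by (auto simp: bij_betw_def)
  have dsub: "dom (\<psi> s) \<subseteq> dom (\<psi> t) \<longleftrightarrow> dom s \<subseteq> dom t" if st: "s \<in> T" "t \<in> T" for s t
  proof -
    have "(\<exists>v\<in>T'. \<psi> s = v \<circ>\<^sub>m \<psi> t) \<longleftrightarrow> (\<exists>u\<in>T. \<psi> s = \<psi> u \<circ>\<^sub>m \<psi> t)"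
      using \<psi> unfolding bij_betw_def by blast
    also have "\<dots> \<longleftrightarrow> (\<exists>u\<in>T. \<psi> s = \<psi> (u \<circ>\<^sub>m t))" using hom[OF st(2)] by simp
    also have "\<dots> \<longleftrightarrow> (\<exists>u\<in>T. s = u \<circ>\<^sub>m t)"
      using \<psi> st cl unfolding bij_betw_def inj_on_def by metis
    finally show ?thesis
      using domain_transversal_dom_subset_iff[OF r T st]
        domain_transversal_dom_subset_iff[OF r' T' \<psi>T[OF st(1)] \<psi>T[OF st(2)]] by simp
  qed
  \<comment> \<open>\<open>\<rho> D\<close> is the element of T with domain D.\<close>
  define \<rho> where "\<rho> = the_inv_into T dom"
  have \<rho>: "bij_betw \<rho> (downsets r) T" unfolding \<rho>_def using dT by (rule bij_betw_the_inv_into)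
  have dom\<rho>: "dom (\<rho> D) = D" if "D \<in> downsets r" for D
    using dT that f_the_inv_into_f_bij_betw[of dom T "downsets r"] by (auto simp: \<rho>_def)
  have \<rho>dom: "\<rho> (dom s) = s" if "s \<in> T" for s
    using dT that by (simp add: \<rho>_def the_inv_into_f_f bij_betw_def)
  have \<rho>T: "\<rho> D \<in> T" if "D \<in> downsets r" for D using \<rho> that by (auto simp: bij_betw_def)
  have bij: "bij_betw (\<lambda>D. dom (\<psi> (\<rho> D))) (downsets r) (downsets r')"
    using bij_betw_trans[OF bij_betw_trans[OF \<rho> \<psi>] dT'] by (simp add: comp_def)
  have mono: "dom (\<psi> (\<rho> D)) \<subseteq> dom (\<psi> (\<rho> E)) \<longleftrightarrow> D \<subseteq> E"
    if "D \<in> downsets r" "E \<in> downsets r" for D E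
    using dsub[OF \<rho>T \<rho>T] dom\<rho> that by simp
  obtain \<pi> where \<pi>: "bij_betw \<pi> (Field r) (Field r')"
    "\<And>p q. p \<in> Field r \<Longrightarrow> q \<in> Field r \<Longrightarrow> (\<pi> p, \<pi> q) \<in> r' \<longleftrightarrow> (p, q) \<in> r"
    "\<And>D. D \<in> downsets r \<Longrightarrow> dom (\<psi> (\<rho> D)) = \<pi> ` D"
    using downset_iso_induced_by_order_iso[OF r r' bij mono] by blast
  have sub: "dom s \<subseteq> Field r" "ran s \<subseteq> Field r" "dom s \<in> downsets r" if "s \<in> T" for s
    using T that unfolding domain_transversal_def partial_autos_def downsets_def by blast+
  have sub': "ran s \<subseteq> Field r'" if "s \<in> T'" for s
    using T' that unfolding domain_transversal_def partial_autos_def downsets_def by blast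
  have mem: "\<pi> p \<in> dom (\<psi> s) \<longleftrightarrow> p \<in> dom s" if s: "s \<in> T" and p: "p \<in> Field r" for s p
    using \<pi>(3)[OF sub(3)[OF s]] \<rho>dom[OF s] p
      inj_on_image_mem_iff[OF bij_betw_imp_inj_on[OF \<pi>(1)] _ sub(1)[OF s]] by simp
  have "\<psi> s (\<pi> p) = map_option \<pi> (s p)" if s: "s \<in> T" and p: "p \<in> Field r" for s p
  proof (cases "s p")
    case None
    then show ?thesis using mem[OF s p] by auto
  next
    case (Some q)
    then obtain q' where q': "\<psi> s (\<pi> p) = Some q'" using mem[OF s p] by auto
    have q: "q \<in> Field r" using Some sub(2)[OF s] by (auto simp: ran_def)
    have "q' \<in> Field r'" using q' sub'[OF \<psi>T[OF s]] by (auto simp: ran_def)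
    then obtain u where u: "u \<in> Field r" "q' = \<pi> u" using \<pi>(1) by (auto simp: bij_betw_def)
    have "q = u"
    proof (rule separated_by_downsets[OF r q u(1)])
      fix D assume D: "D \<in> downsets r"
      let ?t = "\<rho> D"
      have "q \<in> D \<longleftrightarrow> p \<in> dom (?t \<circ>\<^sub>m s)" using Some dom\<rho>[OF D] by (simp add: dom_map_comp)
      also have "\<dots> \<longleftrightarrow> \<pi> p \<in> dom (\<psi> ?t \<circ>\<^sub>m \<psi> s)"
        using mem[OF cl[OF s \<rho>T[OF D]] p] hom[OF s \<rho>T[OF D]] by simp
      also have "\<dots> \<longleftrightarrow> u \<in> D"
        using q' u mem[OF \<rho>T[OF D] u(1)] dom\<rho>[OF D] by (simp add: dom_map_comp)
      finally show "q \<in> D \<longleftrightarrow> u \<in> D" .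
    qed
    then show ?thesis using Some q' u by simp
  qed
  with \<pi>(1,2) show ?thesis using that by blast
qed

section \<open>The partial wreath product acts on a forest\<close>

text \<open>The point (x, None) is a root, a minimal element, and (x, Some u) is the leaf u above it. The
  roots are points in their own right because removing x from the domain of (f, a) changes the
  element even when f x is the empty map, although the same leaves are moved.\<close>
definition forest :: "nat \<Rightarrow> nat \<Rightarrow> (nat \<times> nat option) rel" where
  "forest m n = {((x, i), (y, j)).
     x = y \<and> (i = None \<or> i = j) \<and> y \<in> {1..n} \<and> set_option j \<subseteq> {1..m}}"

lemma Field_forest: "(x, i) \<in> Field (forest m n) \<longleftrightarrow> x \<in> {1..n} \<and> set_option i \<subseteq> {1..m}"
  by (auto simp: Field_def forest_def)

lemma Partial_order_forest: "Partial_order (forest m n)"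
proof -
  have "refl_on (Field (forest m n)) (forest m n)"
    by (auto simp: refl_on_def Field_forest) (auto simp: forest_def)
  moreover have "trans (forest m n)" "antisym (forest m n)"
    by (auto simp: forest_def trans_def antisym_def)
  moreover have "forest m n \<subseteq> Field (forest m n) \<times> Field (forest m n)"
    by (auto intro: FieldI1 FieldI2)
  ultimately show ?thesis by (simp add: partial_order_on_def preorder_on_def)
qed

text \<open>The use of \<open>the (f x)\<close> is harmless: on elements of the semigroup f and a have the same domain.\<close>
fun act :: "pwreath_elt \<Rightarrow> (nat \<times> nat option) \<rightharpoonup> (nat \<times> nat option)" where
  "act (f, a) (x, None) = map_option (\<lambda>y. (y, None)) (a x)"
| "act (f, a) (x, Some u) =
     (case a x of None \<Rightarrow> None
      | Some y \<Rightarrow> map_option (\<lambda>v. (y, Some v)) (the (f x) u))"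

lemma act_mult:
  assumes "p \<in> carrier (pwreath m n)" "q \<in> carrier (pwreath m n)"
  shows "act (p \<otimes>\<^bsub>pwreath m n\<^esub> q) = act q \<circ>\<^sub>m act p"
proof
  fix z :: "nat \<times> nat option"
  obtain f a g b x i where e: "p = (f, a)" "q = (g, b)" "z = (x, i)" by fastforce
  have f: "f x = None \<longleftrightarrow> a x = None" and g: "\<And>y. g y = None \<longleftrightarrow> b y = None"
    using assms by (auto simp: e carrier_pwreath')
  show "act (p \<otimes>\<^bsub>pwreath m n\<^esub> q) z = (act q \<circ>\<^sub>m act p) z"
  proof (cases "a x")
    case None
    then show ?thesis
      by (cases i) (simp_all add: e mult_pwreath mult_inv_symm_sgp map_comp_def)
  next
    case (Some y)
    then obtain h where h: "f x = Some h" using f by auto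
    show ?thesis
    proof (cases "b y")
      case None
      then show ?thesis using Some
        by (cases i) (simp_all add: e mult_pwreath mult_inv_symm_sgp map_comp_def
            split: option.split)
    next
      case (Some y')
      then obtain h' where "g y = Some h'" using g[of y] by auto
      then show ?thesis using Some h \<open>a x = Some y\<close>
        by (cases i) (simp_all add: e mult_pwreath mult_inv_symm_sgp map_comp_def
            pointwise_mult_app split: option.split)
    qed
  qed
qed

lemma act_inj: "inj_on act (carrier (pwreath m n))"
proof (rule inj_onI)
  fix p q assume pq: "p \<in> carrier (pwreath m n)" "q \<in> carrier (pwreath m n)" "act p = act q"
  obtain f a g b where e: "p = (f, a)" "q = (g, b)" by fastforce
  have "map_option (\<lambda>y. (y, None :: nat option)) (a x) = map_option (\<lambda>y. (y, None)) (b x)" for x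
    using fun_cong[OF pq(3), of "(x, None)"] by (simp add: e)
  then have ab: "a = b"
    by (intro ext) (metis (no_types, lifting) option.map_disc_iff option.map_sel prod.inject
        option.expand)
  have "f x = g x" for x
  proof (cases "a x")
    case None
    then have "f x = None" "g x = None" using pq(1,2) unfolding e ab carrier_pwreath' by blast+
    then show ?thesis by simp
  next
    case (Some y)
    then obtain h k where hk: "f x = Some h" "g x = Some k"
      using pq by (metis ab carrier_pwreath' e not_None_eq)
    have "map_option (\<lambda>v. (y, Some v)) (h u) = map_option (\<lambda>v. (y, Some v)) (k u)" for u
      using fun_cong[OF pq(3), of "(x, Some u)"] Some hk by (simp add: e ab)
    then have "h = k"
      by (intro ext) (metis (no_types, lifting) option.map_disc_iff option.map_sel prod.inject
        option.expand option.inject)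
    with hk show ?thesis by simp
  qed
  with ab show "p = q" by (auto simp: e)
qed

lemma act_partial_auto:
  assumes "p \<in> carrier (pwreath m n)" shows "act p \<in> partial_autos (forest m n)"
proof -
  obtain f a where e: "p = (f, a)" by fastforce
  have a: "\<And>x y. a x = Some y \<Longrightarrow> x \<in> {1..n} \<and> y \<in> {1..n}"
      "\<And>x x' y. a x = Some y \<Longrightarrow> a x' = Some y \<Longrightarrow> x = x'"
    using assms unfolding e carrier_pwreath' carrier_inv_symm_sgp' by blast+
  have f: "\<And>u v. the (f x) u = Some v \<Longrightarrow> u \<in> {1..m} \<and> v \<in> {1..m}"
      "\<And>u u' v. the (f x) u = Some v \<Longrightarrow> the (f x) u' = Some v \<Longrightarrow> u = u'"
    if ax: "a x = Some y" for x y
  proof -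
    have "f x = None \<longleftrightarrow> a x = None" using assms unfolding e carrier_pwreath' by blast
    then obtain h where "f x = Some h" using ax by auto
    moreover from this have "h \<in> carrier (inv_symm_sgp m)"
      using assms unfolding e carrier_pwreath' by blast
    ultimately have "the (f x) \<in> carrier (inv_symm_sgp m)" by simp
    then have h: "(\<forall>u v. the (f x) u = Some v \<longrightarrow> u \<in> {1..m} \<and> v \<in> {1..m}) \<and>
        (\<forall>u u' v. the (f x) u = Some v \<longrightarrow> the (f x) u' = Some v \<longrightarrow> u = u')"
      by (simp only: carrier_inv_symm_sgp')
    show "\<And>u v. the (f x) u = Some v \<Longrightarrow> u \<in> {1..m} \<and> v \<in> {1..m}"
      using h by blast
    show "\<And>u u' v. the (f x) u = Some v \<Longrightarrow> the (f x) u' = Some v \<Longrightarrow> u = u'"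
      using h by metis
  qed
  have act: "act p (x, i) = Some (y, j) \<longleftrightarrow> a x = Some y \<and>
      (i = None \<and> j = None \<or> (\<exists>u v. i = Some u \<and> j = Some v \<and> the (f x) u = Some v))" for x i y j
    by (cases i) (auto simp: e split: option.split)
  have field: "x \<in> {1..n} \<and> set_option i \<subseteq> {1..m} \<and> y \<in> {1..n} \<and> set_option j \<subseteq> {1..m}"
    if "act p (x, i) = Some (y, j)" for x i y j
    using that a(1)[of x y] f(1)[of x y] unfolding act by auto
  have order: "((x, i), (x', i')) \<in> forest m n \<longleftrightarrow> ((y, j), (y', j')) \<in> forest m n"
    if q: "act p (x, i) = Some (y, j)" "act p (x', i') = Some (y', j')" for x i x' i' y j y' j'
  proof -
    have "x = x' \<longleftrightarrow> y = y'" using a(2)[of x _ x'] q unfolding act by auto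
    moreover have "i = None \<longleftrightarrow> j = None" using q unfolding act by auto
    moreover have "i = i' \<longleftrightarrow> j = j'" if "x = x'"
    proof -
      have "a x = Some y" using q(1) unfolding act by blast
      note f(2)[OF this]
      with q show ?thesis unfolding act that by (cases i; cases i'; auto)
    qed
    ultimately show ?thesis using field[OF q(1)] field[OF q(2)] by (auto simp: forest_def)
  qed
  have down: "\<exists>y j. act p (x, i) = Some (y, j)"
    if "act p (x', i') = Some (y', j')" "((x, i), (x', i')) \<in> forest m n" for x i x' i' y' j'
    using that unfolding act forest_def by auto
  have up: "\<exists>x i. act p (x, i) = Some (y, j)"
    if "act p (x', i') = Some (y', j')" "((y, j), (y', j')) \<in> forest m n" for y j x' i' y' j'
    using that unfolding act forest_def by auto
  show ?thesis
    unfolding partial_autos_iff split_paired_All split_paired_Ex Field_forest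
    by (intro conjI allI impI;
        (erule (1) order | erule (1) down | erule (1) up | blast dest: field))
qed

text \<open>A partial automorphism sends roots to roots, because its range is a downset, and leaves to
  leaves of the image of their root, because it preserves the order. So it splits into a map a on
  the roots and maps f x on the leaves at x. Together with the three preceding lemmas this
  identifies the partial wreath product with the semigroup of partial automorphisms of the
  forest.\<close>
lemma act_surj:
  assumes h: "h \<in> partial_autos (forest m n)"
  obtains p where "p \<in> carrier (pwreath m n)" "act p = h"
proof -
  note D = partial_autosD[OF h]
  note inj = partial_auto_inj[OF Partial_order_forest h]
  have root: "j = None" if xy: "h (x, None) = Some (y, j)" for x y j
  proof -
    have le: "((y, None), (y, j)) \<in> forest m n"
      using D(2)[OF xy] by (auto simp: Field_forest) (auto simp: forest_def)
    then obtain q where q: "h q = Some (y, None)" using D(5)[OF xy le] by blast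
    then have "(q, (x, None)) \<in> forest m n" using D(3)[OF q xy] le by blast
    then have "q = (x, None)" by (auto simp: forest_def)
    then show ?thesis using xy q by simp
  qed
  have leaf: "h (x, None) = Some (y, None) \<and> j \<noteq> None" if xy: "h (x, Some u) = Some (y, j)" for x u y j
  proof -
    have le: "((x, None), (x, Some u)) \<in> forest m n"
      using D(1)[OF xy] by (auto simp: Field_forest) (auto simp: forest_def)
    then obtain y' j' where y': "h (x, None) = Some (y', j')" using D(4)[OF xy le] by auto
    then have "((y', j'), (y, j)) \<in> forest m n" using D(3)[OF y' xy] le by blast
    then have "y' = y" by (simp add: forest_def)
    then have *: "h (x, None) = Some (y, None)" using y' root[OF y'] by simp
    moreover have "j \<noteq> None" using inj[OF *, of "(x, Some u)"] xy by auto
    ultimately show ?thesis by blast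
  qed
  define a where "a x = map_option fst (h (x, None))" for x
  define f where "f x = map_option (\<lambda>_. \<lambda>u. Option.bind (h (x, Some u)) snd) (h (x, None))" for x
  have a: "a x = Some y \<longleftrightarrow> h (x, None) = Some (y, None)" for x y
    using root by (auto simp: a_def)
  have f: "Option.bind (h (x, Some u)) snd = Some v \<longleftrightarrow> (\<exists>y. h (x, Some u) = Some (y, Some v))" for x u v
    by (cases "h (x, Some u)") auto
  have field: "h (x, None) = Some (y, None) \<Longrightarrow> x \<in> {1..n} \<and> y \<in> {1..n}"
    "h (x, Some w) = Some (y, Some v) \<Longrightarrow> w \<in> {1..m} \<and> v \<in> {1..m}" for x y w v
    using D(1)[of "(x, None)" "(y, None)"] D(2)[of "(x, None)" "(y, None)"]
      D(1)[of "(x, Some w)" "(y, Some v)"] D(2)[of "(x, Some w)" "(y, Some v)"]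
    by (auto simp: Field_forest)
  have root_inj: "x = x'" if "h (x, None) = Some (y, None)" "h (x', None) = Some (y, None)" for x x' y
    using inj[OF that] by simp
  have leaf_inj: "w = w'"
    if w: "h (x, Some w) = Some (y, Some v)" "h (x, Some w') = Some (y', Some v)" for x w w' y y' v
  proof -
    have "y = y'" using leaf[OF w(1)] leaf[OF w(2)] by simp
    then show ?thesis using inj[OF w(1)] w(2) by auto
  qed
  have "act (f, a) (x, i) = h (x, i)" for x i
  proof (cases i)
    case None
    then show ?thesis using root by (cases "h (x, None)") (auto simp: a_def)
  next
    case (Some u)
    show ?thesis
    proof (cases "h (x, Some u)")
      case None
      then show ?thesis by (cases "h (x, None)") (auto simp: a_def f_def Some)
    next
      case (Some q)
      then obtain y v where "h (x, Some u) = Some (y, Some v)" "h (x, None) = Some (y, None)"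
        using leaf by (cases q) force
      then show ?thesis by (simp add: a_def f_def \<open>i = Some u\<close>)
    qed
  qed
  then have "act (f, a) = h" by auto
  moreover have "(f, a) \<in> carrier (pwreath m n)"
    unfolding carrier_pwreath'
  proof (intro conjI allI impI)
    show "a \<in> carrier (inv_symm_sgp n)"
      unfolding carrier_inv_symm_sgp' a
      using field(1) root_inj by blast
    show "f x = None \<longleftrightarrow> a x = None" for x by (simp add: a_def f_def)
    show "u \<in> carrier (inv_symm_sgp m)" if "f x = Some u" for x u
    proof -
      from that have u: "u = (\<lambda>u. Option.bind (h (x, Some u)) snd)"
        by (auto simp: f_def)
      show ?thesis
        unfolding carrier_inv_symm_sgp' u f using field(2) leaf_inj by blast
    qed
  qed
  ultimately show ?thesis using that by blast
qed

section \<open>Green's relation R\<close>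

text \<open>In an inverse semigroup q divides p on the left as soon as the domain of q is large enough: the
  cofactor is the inverse of q followed by p.\<close>
lemma left_divides_if_dom_subset:
  assumes p: "p \<in> carrier (pwreath m n)" and q: "q \<in> carrier (pwreath m n)"
    and sub: "dom (act p) \<subseteq> dom (act q)"
  obtains s where "s \<in> carrier (pwreath m n)" "p = q \<otimes>\<^bsub>pwreath m n\<^esub> s"
proof -
  interpret monoid "pwreath m n" by (rule monoid_pwreath)
  note Q = act_partial_auto[OF q]
  obtain k where k: "k \<in> partial_autos (forest m n)" "\<And>x y. k y = Some x \<longleftrightarrow> act q x = Some y"
    using partial_auto_converse[OF Partial_order_forest Q] by blast
  obtain q' where q': "q' \<in> carrier (pwreath m n)" "act q' = k" using act_surj[OF k(1)] by blast
  have "act p z = (act p \<circ>\<^sub>m (k \<circ>\<^sub>m act q)) z" for z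
  proof (cases "act q z")
    case None
    then show ?thesis using sub by (auto simp: map_comp_def)
  next
    case (Some y)
    then have "k y = Some z" using k(2) by blast
    then show ?thesis using Some by (simp add: map_comp_def)
  qed
  then have "act p = act p \<circ>\<^sub>m (k \<circ>\<^sub>m act q)" by (rule ext)
  then have "act p = act (q \<otimes>\<^bsub>pwreath m n\<^esub> (q' \<otimes>\<^bsub>pwreath m n\<^esub> p))"
    by (simp only: act_mult[OF q m_closed[OF q'(1) p]] act_mult[OF q'(1) p] q'(2) map_comp_assoc)
  then have "p = q \<otimes>\<^bsub>pwreath m n\<^esub> (q' \<otimes>\<^bsub>pwreath m n\<^esub> p)"
    using inj_onD[OF act_inj] p q q' by blast
  with that p q' show ?thesis by blast
qed

text \<open>Multiplying on the right can only shrink the domain of the action, and by the previous lemma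
  every element with a smaller domain arises in this way.\<close>
lemma green_R_iff_same_dom:
  assumes "p \<in> carrier (pwreath m n)" "q \<in> carrier (pwreath m n)"
  shows "(p, q) \<in> green_R (pwreath m n) \<longleftrightarrow> dom (act p) = dom (act q)"
proof -
  interpret monoid "pwreath m n" by (rule monoid_pwreath)
  have sub: "dom (act p) \<subseteq> dom (act q)"
    if pq: "p \<in> carrier (pwreath m n)" "q \<in> carrier (pwreath m n)"
      and eq: "p <#\<^bsub>pwreath m n\<^esub> carrier (pwreath m n) = q <#\<^bsub>pwreath m n\<^esub> carrier (pwreath m n)" for p q
  proof -
    have "p \<otimes>\<^bsub>pwreath m n\<^esub> \<one>\<^bsub>pwreath m n\<^esub> \<in> p <#\<^bsub>pwreath m n\<^esub> carrier (pwreath m n)"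
      unfolding l_coset_def using one_closed by blast
    then obtain s where s: "s \<in> carrier (pwreath m n)" "p = q \<otimes>\<^bsub>pwreath m n\<^esub> s"
      using pq(1) unfolding eq by (auto simp: l_coset_def)
    show ?thesis
      unfolding s(2) act_mult[OF pq(2) s(1)] by (auto simp: map_comp_def split: option.splits)
  qed
  have coset: "p <#\<^bsub>pwreath m n\<^esub> carrier (pwreath m n) \<subseteq> q <#\<^bsub>pwreath m n\<^esub> carrier (pwreath m n)"
    if pq: "p \<in> carrier (pwreath m n)" "q \<in> carrier (pwreath m n)"
      and sub: "dom (act p) \<subseteq> dom (act q)" for p q
  proof -
    obtain s where s: "s \<in> carrier (pwreath m n)" "p = q \<otimes>\<^bsub>pwreath m n\<^esub> s"
      using left_divides_if_dom_subset[OF pq sub] by blast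
    show ?thesis unfolding l_coset_def s(2) using pq s(1) m_assoc by fastforce
  qed
  have "(p, q) \<in> green_R (pwreath m n) \<longleftrightarrow>
      p <#\<^bsub>pwreath m n\<^esub> carrier (pwreath m n) = q <#\<^bsub>pwreath m n\<^esub> carrier (pwreath m n)"
    using assms by (simp add: green_R_def)
  then show ?thesis
    using sub[OF assms] sub[OF assms(2,1)] coset[OF assms] coset[OF assms(2,1)]
    by (metis subset_antisym subset_refl)
qed

text \<open>Every downset is the domain of a class because the identity on it is a partial
  automorphism.\<close>
lemma R_cross_section_domain_transversal:
  assumes R: "R_cross_section (pwreath m n) R"
  shows "domain_transversal (forest m n) (act ` R)"
proof -
  let ?S = "pwreath m n"
  have RS: "R \<subseteq> carrier ?S" and cl: "\<And>p q. p \<in> R \<Longrightarrow> q \<in> R \<Longrightarrow> p \<otimes>\<^bsub>?S\<^esub> q \<in> R"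
    and ex1: "\<And>C. C \<in> carrier ?S // green_R ?S \<Longrightarrow> \<exists>!t. t \<in> R \<inter> C"
    using R by (simp_all add: R_cross_section_def)
  have inj: "p = q" if pq: "p \<in> R" "q \<in> R" "dom (act p) = dom (act q)" for p q
  proof -
    have S: "p \<in> carrier ?S" "q \<in> carrier ?S" using pq(1,2) RS by auto
    have "p \<in> R \<inter> green_R ?S `` {p}" "q \<in> R \<inter> green_R ?S `` {p}"
      using green_R_iff_same_dom[OF S(1) S(1)] green_R_iff_same_dom[OF S] pq by simp_all
    then show ?thesis using ex1[OF quotientI[OF S(1)]] by (elim ex1E) metis
  qed
  have surj: "D \<in> dom ` act ` R" if D: "D \<in> downsets (forest m n)" for D
  proof -
    obtain e where e: "e \<in> carrier ?S" "act e = Some |` D"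
      using act_surj[OF partial_auto_restrict_id[OF D]] by blast
    obtain t where t: "t \<in> R" "(e, t) \<in> green_R ?S" using ex1[OF quotientI[OF e(1)]] by blast
    then have "dom (act t) = dom (act e)" using green_R_iff_same_dom[OF e(1), of t] RS by blast
    also have "\<dots> = D" by (simp add: e(2))
    finally show ?thesis using t(1) by blast
  qed
  have sub: "act ` R \<subseteq> partial_autos (forest m n)" using act_partial_auto RS by blast
  moreover have "bij_betw dom (act ` R) (downsets (forest m n))"
    unfolding bij_betw_def
  proof
    show "inj_on dom (act ` R)" by (rule inj_onI) (auto dest: inj)
    have "dom ` act ` R \<subseteq> downsets (forest m n)" using sub by (auto simp: partial_autos_def)
    with surj show "dom ` act ` R = downsets (forest m n)" by blast
  qed
  moreover have "t \<circ>\<^sub>m s \<in> act ` R" if st: "s \<in> act ` R" "t \<in> act ` R" for s t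
  proof -
    obtain p q where pq: "p \<in> R" "q \<in> R" "s = act p" "t = act q" using st by blast
    then have "p \<in> carrier ?S" "q \<in> carrier ?S" using RS by blast+
    then have "t \<circ>\<^sub>m s = act (p \<otimes>\<^bsub>?S\<^esub> q)" using pq(3,4) act_mult[of p m n q] by simp
    then show ?thesis using cl pq by blast
  qed
  ultimately show ?thesis unfolding domain_transversal_def by blast
qed

section \<open>Automorphisms of the forest\<close>

lemma total_pmap_is_perm:
  assumes a: "a \<in> carrier (inv_symm_sgp n)" and tot: "dom a = {1..n}"
  obtains p where "p \<in> carrier (sym_group n)" "a = perm_pmap n p"
proof -
  define p where "p x = (if x \<in> {1..n} then the (a x) else x)" for x
  have ap: "a x = Some (p x)" if "x \<in> {1..n}" for x
  proof -
    have "x \<in> dom a" using that tot by simp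
    then show ?thesis using that by (auto simp: p_def)
  qed
  have "p x \<in> {1..n}" if "x \<in> {1..n}" for x
    using ap[OF that] a unfolding carrier_inv_symm_sgp' by blast
  then have "p ` {1..n} \<subseteq> {1..n}" by (rule image_subsetI)
  moreover have "inj_on p {1..n}"
  proof (rule inj_onI)
    fix x y assume "x \<in> {1..n}" "y \<in> {1..n}" "p x = p y"
    then have "a x = Some (p y)" "a y = Some (p y)" using ap[of x] ap[of y] by simp_all
    then show "x = y" using a unfolding carrier_inv_symm_sgp' by blast
  qed
  ultimately have "bij_betw p {1..n} {1..n}"
    unfolding bij_betw_def using endo_inj_surj[OF finite_atLeastAtMost] by blast
  then have "p permutes {1..n}" by (rule bij_imp_permutes) (auto simp: p_def)
  moreover have "a = perm_pmap n p"
    using ap tot by (auto simp: perm_pmap_def restrict_map_def fun_eq_iff)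
  ultimately show ?thesis using that by (simp add: sym_group_carrier)
qed

text \<open>An automorphism \<open>\<pi>\<close> of the whole forest is a partial automorphism defined everywhere, so it
  comes from some (f, a). Being defined on all roots and all leaves makes a and every f x total
  and therefore permutations.\<close>
lemma forest_automorphism_is_perm:
  assumes bij: "bij_betw \<pi> (Field (forest m n)) (Field (forest m n))"
    and order: "\<And>p q. p \<in> Field (forest m n) \<Longrightarrow> q \<in> Field (forest m n) \<Longrightarrow>
      (\<pi> p, \<pi> q) \<in> forest m n \<longleftrightarrow> (p, q) \<in> forest m n"
  obtains v t where "v \<in> {1..n} \<rightarrow> carrier (sym_group m)" "t \<in> carrier (sym_group n)"
    and "act (perm_pwreath m n (v, t)) = (Some \<circ> \<pi>) |` Field (forest m n)"
proof -
  let ?F = "forest m n"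
  let ?h = "(Some \<circ> \<pi>) |` Field ?F"
  have h: "?h x = Some y \<longleftrightarrow> x \<in> Field ?F \<and> y = \<pi> x" for x y
    by (auto simp: restrict_map_def)
  have "?h \<in> partial_autos ?F"
    unfolding partial_autos_iff h
  proof (intro conjI allI impI; (elim conjE)?)
    fix x' y' y assume "x' \<in> Field ?F" "y' = \<pi> x'" "(y, y') \<in> ?F"
    then have "y \<in> \<pi> ` Field ?F" using bij by (auto simp: bij_betw_def intro: FieldI1)
    then show "\<exists>x. x \<in> Field ?F \<and> y = \<pi> x" by blast
  next
    fix x' y' x assume "(x, x') \<in> ?F"
    then show "\<exists>y. x \<in> Field ?F \<and> y = \<pi> x" by (blast intro: FieldI1)
  next
    fix x x' y y' assume "x \<in> Field ?F" "y = \<pi> x" "x' \<in> Field ?F" "y' = \<pi> x'"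
    then show "(x, x') \<in> ?F \<longleftrightarrow> (y, y') \<in> ?F" using order[of x x'] by simp
  next
    fix x y assume "x \<in> Field ?F" "y = \<pi> x"
    then show "x \<in> Field ?F" "y \<in> Field ?F" using bij_betwE[OF bij] by auto
  qed
  from act_surj[OF this] obtain p where p: "p \<in> carrier (pwreath m n)" "act p = ?h" .
  obtain f a where "p = (f, a)" by (cases p)
  note fa = p[unfolded this]
  have a: "a \<in> carrier (inv_symm_sgp n)" and fdom: "\<And>x. f x = None \<longleftrightarrow> a x = None"
    and f: "\<And>x u. f x = Some u \<Longrightarrow> u \<in> carrier (inv_symm_sgp m)"
    using fa(1) unfolding carrier_pwreath' by blast+
  have "a x \<noteq> None" if "x \<in> {1..n}" for x
  proof -
    have "act (f, a) (x, None) \<noteq> None" unfolding fa(2) using that by (simp add: Field_forest)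
    then show ?thesis by simp
  qed
  then have "{1..n} \<subseteq> dom a" unfolding dom_def by blast
  then have doma: "dom a = {1..n}" using a unfolding carrier_inv_symm_sgp by blast
  from total_pmap_is_perm[OF a this] obtain t
    where t: "t \<in> carrier (sym_group n)" "a = perm_pmap n t" .
  have "\<exists>w. w \<in> carrier (sym_group m) \<and> f x = Some (perm_pmap m w)" if x: "x \<in> {1..n}" for x
  proof -
    have "x \<in> dom a" using x doma by simp
    from domD[OF this] obtain y where y: "a x = Some y" ..
    then obtain u where u: "f x = Some u" using fdom[of x] by auto
    have "u i \<noteq> None" if "i \<in> {1..m}" for i
    proof -
      have "act (f, a) (x, Some i) \<noteq> None" unfolding fa(2) using that x by (simp add: Field_forest)
      then show ?thesis using y u by simp
    qed
    then have "{1..m} \<subseteq> dom u" unfolding dom_def by blast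
    then have "dom u = {1..m}" using f[OF u] unfolding carrier_inv_symm_sgp by blast
    from total_pmap_is_perm[OF f[OF u] this] obtain w
      where "w \<in> carrier (sym_group m)" "u = perm_pmap m w" .
    then show ?thesis using u by blast
  qed
  then have "\<forall>x\<in>{1..n}. \<exists>w. w \<in> carrier (sym_group m) \<and> f x = Some (perm_pmap m w)" by simp
  from bchoice[OF this] obtain v
    where v: "\<forall>x\<in>{1..n}. v x \<in> carrier (sym_group m) \<and> f x = Some (perm_pmap m (v x))" ..
  have "f x = None" if "x \<notin> {1..n}" for x
    using that unfolding fdom doma[symmetric] by (simp add: domIff)
  then have "f = (\<lambda>x. Some (perm_pmap m (v x))) |` {1..n}"
    using v by (intro ext) (simp add: restrict_map_def)
  then have "perm_pwreath m n (v, t) = (f, a)" by (simp add: perm_pwreath_def t(2))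
  then have "act (perm_pwreath m n (v, t)) = ?h" using fa(2) by simp
  moreover have "v \<in> {1..n} \<rightarrow> carrier (sym_group m)" using v by blast
  ultimately show ?thesis by (intro that[OF _ t(1)])
qed

text \<open>The equation of conjugation, multiplied out so that no inverse occurs, determines b and g at
  the image of each root under t.\<close>
lemma conjugate_coordinates:
  assumes v: "v \<in> {1..n} \<rightarrow> carrier (sym_group m)" and t: "t \<in> carrier (sym_group n)"
    and fa: "(f, a) \<in> carrier (pwreath m n)" and gb: "(g, b) \<in> carrier (pwreath m n)"
    and eq: "perm_pwreath m n (v, t) \<otimes>\<^bsub>pwreath m n\<^esub> (g, b) = (f, a) \<otimes>\<^bsub>pwreath m n\<^esub> perm_pwreath m n (v, t)"
  shows "dom b = t ` dom a"
    and "x \<in> dom a \<Longrightarrow> b (t x) = Some (t (the (a x)))"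
    and "x \<in> dom a \<Longrightarrow> g (t x) = Some (perm_pmap m (inv\<^bsub>sym_group m\<^esub> (v x))
          \<otimes>\<^bsub>inv_symm_sgp m\<^esub> the (f x) \<otimes>\<^bsub>inv_symm_sgp m\<^esub> perm_pmap m (v (the (a x))))"
proof -
  interpret M: monoid "inv_symm_sgp m" by (rule monoid_inv_symm_sgp)
  interpret G: group "sym_group m" by (rule sym_group_is_group)
  have tp: "t permutes {1..n}" using t by (simp add: sym_group_carrier)
  have a: "\<And>x y. a x = Some y \<Longrightarrow> x \<in> {1..n} \<and> y \<in> {1..n}"
    using fa unfolding carrier_pwreath' carrier_inv_symm_sgp' by blast
  have b: "\<And>x y. b x = Some y \<Longrightarrow> x \<in> {1..n} \<and> y \<in> {1..n}"
    using gb unfolding carrier_pwreath' carrier_inv_symm_sgp' by blast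
  have E: "b \<circ>\<^sub>m perm_pmap n t = perm_pmap n t \<circ>\<^sub>m a"
    "pointwise_mult m ((\<lambda>x. Some (perm_pmap m (v x))) |` {1..n}) (g \<circ>\<^sub>m perm_pmap n t) =
     pointwise_mult m f ((\<lambda>x. Some (perm_pmap m (v x))) |` {1..n} \<circ>\<^sub>m a)"
    using eq by (simp_all add: perm_pwreath_def mult_pwreath mult_inv_symm_sgp)
  have bt: "b (t x) = map_option t (a x)" if "x \<in> {1..n}" for x
    using fun_cong[OF E(1), of x] that a[of x]
    by (cases "a x") (auto simp: perm_pmap_def map_comp_def)
  show "dom b = t ` dom a"
  proof (intro Set.set_eqI iffI)
    fix y assume y: "y \<in> dom b"
    then have "y \<in> {1..n}" using b by blast
    then obtain x where x: "x \<in> {1..n}" "y = t x" using permutes_image[OF tp] by blast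
    then have "x \<in> dom a" using y bt[OF x(1)] by (cases "a x") auto
    with x show "y \<in> t ` dom a" by blast
  qed (use a bt in fastforce)
  assume "x \<in> dom a"
  then obtain y where y: "a x = Some y" by blast
  then have xn: "x \<in> {1..n}" "y \<in> {1..n}" using a by blast+
  show bx: "b (t x) = Some (t (the (a x)))" using bt[OF xn(1)] y by simp
  obtain u where u: "f x = Some u" using fa y unfolding carrier_pwreath' by fastforce
  have "g (t x) \<noteq> None" using gb bx unfolding carrier_pwreath' by auto
  then obtain w where w: "g (t x) = Some w" by blast
  have wc: "w \<in> carrier (inv_symm_sgp m)" using gb w unfolding carrier_pwreath' by blast
  have vx: "v x \<in> carrier (sym_group m)" using v xn by blast
  have ivx: "inv\<^bsub>sym_group m\<^esub> (v x) \<in> carrier (sym_group m)" by (rule G.inv_closed[OF vx])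
  have vp: "perm_pmap m (v x) \<in> carrier (inv_symm_sgp m)"
    and ivp: "perm_pmap m (inv\<^bsub>sym_group m\<^esub> (v x)) \<in> carrier (inv_symm_sgp m)"
    and vyp: "perm_pmap m (v y) \<in> carrier (inv_symm_sgp m)"
    using vx ivx v xn by (auto simp: sym_group_carrier intro!: perm_pmap_carrier)
  have uc: "u \<in> carrier (inv_symm_sgp m)" using fa u unfolding carrier_pwreath' by blast
  have *: "perm_pmap m (v x) \<otimes>\<^bsub>inv_symm_sgp m\<^esub> w = u \<otimes>\<^bsub>inv_symm_sgp m\<^esub> perm_pmap m (v y)"
    using fun_cong[OF E(2), of x] xn y u w
    by (simp add: pointwise_mult_app perm_pmap_def[of n] map_comp_def)
  have "v x \<circ> inv\<^bsub>sym_group m\<^esub> (v x) = id"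
    using G.r_inv[OF vx] by (simp add: sym_group_mult sym_group_one)
  then have "perm_pmap m (inv\<^bsub>sym_group m\<^esub> (v x)) \<otimes>\<^bsub>inv_symm_sgp m\<^esub> perm_pmap m (v x) = \<one>\<^bsub>inv_symm_sgp m\<^esub>"
    using ivx by (simp add: perm_pmap_mult sym_group_carrier perm_pmap_id)
  then have "w = perm_pmap m (inv\<^bsub>sym_group m\<^esub> (v x)) \<otimes>\<^bsub>inv_symm_sgp m\<^esub> (perm_pmap m (v x) \<otimes>\<^bsub>inv_symm_sgp m\<^esub> w)"
    using wc vp ivp by (simp add: M.m_assoc[symmetric])
  then show "g (t x) = Some (perm_pmap m (inv\<^bsub>sym_group m\<^esub> (v x))
          \<otimes>\<^bsub>inv_symm_sgp m\<^esub> the (f x) \<otimes>\<^bsub>inv_symm_sgp m\<^esub> perm_pmap m (v (the (a x))))"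
    using w u y * uc ivp vyp by (simp add: M.m_assoc)
qed

section \<open>Isomorphisms of R-cross-sections\<close>

text \<open>The isomorphism is transported along the faithful action, where it is induced by an
  automorphism of the forest; that automorphism is the action of a pair (v, t).\<close>
lemma R_cross_section_iso_is_conjugation:
  assumes R: "R_cross_section (pwreath m n) R" and R': "R_cross_section (pwreath m n) R'"
    and \<phi>: "\<phi> \<in> iso ((pwreath m n)\<lparr>carrier := R\<rparr>) ((pwreath m n)\<lparr>carrier := R'\<rparr>)"
  obtains v t where "v \<in> {1..n} \<rightarrow> carrier (sym_group m)" "t \<in> carrier (sym_group n)"
    and "\<And>p. p \<in> R \<Longrightarrow> perm_pwreath m n (v, t) \<otimes>\<^bsub>pwreath m n\<^esub> \<phi> p =
                        p \<otimes>\<^bsub>pwreath m n\<^esub> perm_pwreath m n (v, t)"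
proof -
  let ?S = "pwreath m n" and ?F = "forest m n"
  interpret monoid ?S by (rule monoid_pwreath)
  have RS: "p \<in> carrier ?S" if "p \<in> R" for p using R that unfolding R_cross_section_def by blast
  have RS': "p \<in> carrier ?S" if "p \<in> R'" for p using R' that unfolding R_cross_section_def by blast
  have cl: "p \<otimes>\<^bsub>?S\<^esub> q \<in> R" if "p \<in> R" "q \<in> R" for p q
    using R that unfolding R_cross_section_def by blast
  have bij: "bij_betw \<phi> R R'"
    and mult: "\<And>p q. p \<in> R \<Longrightarrow> q \<in> R \<Longrightarrow> \<phi> (p \<otimes>\<^bsub>?S\<^esub> q) = \<phi> p \<otimes>\<^bsub>?S\<^esub> \<phi> q"
    using \<phi> by (auto simp: iso_def hom_def)
  have \<phi>S: "\<phi> p \<in> carrier ?S" if "p \<in> R" for p using RS' bij_betwE[OF bij] that by blast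
  have inj: "inj_on act R" "inj_on act R'"
    using inj_on_subset[OF act_inj] RS RS' by blast+
  define \<psi> where "\<psi> = act \<circ> \<phi> \<circ> the_inv_into R act"
  have \<psi>: "\<psi> (act p) = act (\<phi> p)" if "p \<in> R" for p
    using the_inv_into_f_f[OF inj(1) that] by (simp add: \<psi>_def)
  have "bij_betw act R (act ` R)" "bij_betw act R' (act ` R')"
    using inj by (simp_all add: inj_on_imp_bij_betw)
  then have bij\<psi>: "bij_betw \<psi> (act ` R) (act ` R')"
    unfolding \<psi>_def using bij by (blast intro: bij_betw_trans bij_betw_the_inv_into)
  have hom\<psi>: "\<psi> (s' \<circ>\<^sub>m s) = \<psi> s' \<circ>\<^sub>m \<psi> s" if s: "s \<in> act ` R" "s' \<in> act ` R" for s s'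
  proof -
    obtain p q where pq: "p \<in> R" "q \<in> R" "s = act p" "s' = act q" using s by blast
    have "s' \<circ>\<^sub>m s = act (p \<otimes>\<^bsub>?S\<^esub> q)" using act_mult[of p m n q] RS pq by simp
    then have "\<psi> (s' \<circ>\<^sub>m s) = act (\<phi> p \<otimes>\<^bsub>?S\<^esub> \<phi> q)" using \<psi>[OF cl] mult pq by simp
    then show ?thesis using act_mult[of "\<phi> p" m n "\<phi> q"] \<phi>S \<psi> pq by simp
  qed
  obtain \<pi> where \<pi>: "bij_betw \<pi> (Field ?F) (Field ?F)"
    "\<And>p q. p \<in> Field ?F \<Longrightarrow> q \<in> Field ?F \<Longrightarrow> (\<pi> p, \<pi> q) \<in> ?F \<longleftrightarrow> (p, q) \<in> ?F"
    "\<And>s z. s \<in> act ` R \<Longrightarrow> z \<in> Field ?F \<Longrightarrow> \<psi> s (\<pi> z) = map_option \<pi> (s z)"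
    using domain_transversal_iso_induced_by_order_iso[OF Partial_order_forest Partial_order_forest
        R_cross_section_domain_transversal[OF R] R_cross_section_domain_transversal[OF R'] bij\<psi> hom\<psi>]
    by blast
  obtain v t where vt: "v \<in> {1..n} \<rightarrow> carrier (sym_group m)" "t \<in> carrier (sym_group n)"
    "act (perm_pwreath m n (v, t)) = (Some \<circ> \<pi>) |` Field ?F"
    using forest_automorphism_is_perm[OF \<pi>(1,2)] by blast
  let ?\<Theta> = "perm_pwreath m n (v, t)"
  have \<Theta>: "?\<Theta> \<in> carrier ?S" using perm_pwreath_carrier[OF vt(1,2)] .
  have "?\<Theta> \<otimes>\<^bsub>?S\<^esub> \<phi> p = p \<otimes>\<^bsub>?S\<^esub> ?\<Theta>" if p: "p \<in> R" for p
  proof -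
    note P = partial_autosD[OF act_partial_auto[OF RS[OF p]]]
    have "act (?\<Theta> \<otimes>\<^bsub>?S\<^esub> \<phi> p) z = act (p \<otimes>\<^bsub>?S\<^esub> ?\<Theta>) z" for z
    proof (cases "z \<in> Field ?F")
      case False
      then have "act p z = None" using P(1)[of z] by (cases "act p z") auto
      then show ?thesis
        using False by (simp add: act_mult[OF \<Theta> \<phi>S[OF p]] act_mult[OF RS[OF p] \<Theta>] vt(3) map_comp_def)
    next
      case True
      have "act (\<phi> p) (\<pi> z) = map_option \<pi> (act p z)" using \<pi>(3)[OF _ True] \<psi>[OF p] p by force
      then show ?thesis using True P(2)[of z]
        by (cases "act p z")
          (simp_all add: act_mult[OF \<Theta> \<phi>S[OF p]] act_mult[OF RS[OF p] \<Theta>] vt(3) map_comp_def)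
    qed
    then show ?thesis using inj_onD[OF act_inj] \<Theta> \<phi>S[OF p] RS[OF p] by blast
  qed
  with vt(1,2) that show ?thesis by blast
qed

theorem theorem4:
  fixes m n :: nat
    and R' R'' :: "pwreath_elt set"
    and \<phi> :: "pwreath_elt \<Rightarrow> pwreath_elt"
  assumes "m \<ge> 1" and "n \<ge> 1"
    and "R_cross_section (pwreath m n) R'"
    and "R_cross_section (pwreath m n) R''"
    and "\<phi> \<in> iso ((pwreath m n)\<lparr>carrier := R'\<rparr>) ((pwreath m n)\<lparr>carrier := R''\<rparr>)"
  shows "\<exists>\<theta> \<in> carrier (sym_group n). \<exists>vartheta \<in> {1..n} \<rightarrow> carrier (sym_group m).
    let \<Theta> = perm_pwreath m n (vartheta, \<theta>) in
      (\<forall>(f, a) \<in> R'.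
         \<phi> (f, a) = inv\<^bsub>pwreath m n\<^esub> \<Theta> \<otimes>\<^bsub>pwreath m n\<^esub> (f, a) \<otimes>\<^bsub>pwreath m n\<^esub> \<Theta>) \<and>
      (\<forall>(f, a) \<in> R'. \<forall>g b. \<phi> (f, a) = (g, b) \<longrightarrow>
         dom b = \<theta> ` dom a \<and>
         (\<forall>x \<in> dom a.
            b (\<theta> x) = Some (\<theta> (the (a x))) \<and>
            g (\<theta> x) = Some (perm_pmap m (inv\<^bsub>sym_group m\<^esub> (vartheta x))
                             \<otimes>\<^bsub>inv_symm_sgp m\<^esub> the (f x)
                             \<otimes>\<^bsub>inv_symm_sgp m\<^esub> perm_pmap m (vartheta (the (a x))))))"
proof -
  let ?S = "pwreath m n"
  interpret monoid ?S by (rule monoid_pwreath)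
  obtain v t where v: "v \<in> {1..n} \<rightarrow> carrier (sym_group m)" and t: "t \<in> carrier (sym_group n)"
    and comm: "\<And>p. p \<in> R' \<Longrightarrow> perm_pwreath m n (v, t) \<otimes>\<^bsub>?S\<^esub> \<phi> p = p \<otimes>\<^bsub>?S\<^esub> perm_pwreath m n (v, t)"
    using R_cross_section_iso_is_conjugation[OF assms(3-5)] by blast
  let ?\<Theta> = "perm_pwreath m n (v, t)"
  have \<Theta>: "?\<Theta> \<in> Units ?S" using v t by (rule perm_pwreath_Units)
  have R': "p \<in> carrier ?S" "\<phi> p \<in> carrier ?S" if "p \<in> R'" for p
    using assms(3-5) that unfolding R_cross_section_def iso_def hom_def by auto
  have conj: "\<phi> p = inv\<^bsub>?S\<^esub> ?\<Theta> \<otimes>\<^bsub>?S\<^esub> p \<otimes>\<^bsub>?S\<^esub> ?\<Theta>" if p: "p \<in> R'" for p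
  proof -
    note closed = R'[OF p] Units_closed[OF \<Theta>] Units_inv_closed[OF \<Theta>]
    have "\<phi> p = inv\<^bsub>?S\<^esub> ?\<Theta> \<otimes>\<^bsub>?S\<^esub> ?\<Theta> \<otimes>\<^bsub>?S\<^esub> \<phi> p"
      by (simp only: Units_l_inv[OF \<Theta>] l_one closed)
    also have "\<dots> = inv\<^bsub>?S\<^esub> ?\<Theta> \<otimes>\<^bsub>?S\<^esub> (p \<otimes>\<^bsub>?S\<^esub> ?\<Theta>)"
      by (simp only: m_assoc closed comm[OF p])
    also have "\<dots> = inv\<^bsub>?S\<^esub> ?\<Theta> \<otimes>\<^bsub>?S\<^esub> p \<otimes>\<^bsub>?S\<^esub> ?\<Theta>"
      by (simp only: m_assoc closed)
    finally show ?thesis .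
  qed
  have coord: "dom b = t ` dom a \<and> (\<forall>x \<in> dom a. b (t x) = Some (t (the (a x))) \<and>
      g (t x) = Some (perm_pmap m (inv\<^bsub>sym_group m\<^esub> (v x)) \<otimes>\<^bsub>inv_symm_sgp m\<^esub> the (f x)
        \<otimes>\<^bsub>inv_symm_sgp m\<^esub> perm_pmap m (v (the (a x)))))"
    if p: "(f, a) \<in> R'" and gb: "\<phi> (f, a) = (g, b)" for f a g b
    using conjugate_coordinates[OF v t R'(1)[OF p] R'(2)[OF p, unfolded gb] comm[OF p, unfolded gb]]
    by blast
  show ?thesis
    unfolding Let_def
    by (intro bexI[OF _ t] bexI[OF _ v] conjI) (use conj coord in blast)+
qed

end
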